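(* Let $(\Gamma,v_0)$ be a pointed graph with $I(\Gamma,v_0)=\{0,1,2\}$ satisfying the following two conditions: (S1) for every $i\in I(\Gamma,v_0)$ and all $v,w\in V$, $|S_i(v)|=|S_i(w)|$; (S2) for all $i,j,k\in I(\Gamma,v_0)$ and all $v,w\in S_k(v_0)$, $|S_i(v)\cap S_j(v_0)|=|S_i(w)\cap S_j(v_0)|$. Then $(\Gamma,v_0)$ is hypergroup productive.
   Context: All graphs $\Gamma$, with vertex set $V$, are simple, connected, locally finite, self-centered (all vertices have the same eccentricity), and have at most countably many vertices. $d$ is the graph distance on $V$. A pointed graph $(\Gamma,v_0)$ is a graph with a chosen base point $v_0\in V$. For $v\in V$ and $k\in\mathbb{N}_0$, $S_k(v)=\{w\in V: d(v,w)=k\}$. Put $I(\Gamma,v_0)=\{d(v_0,v): v\in V\}$. The algebra $H(\Gamma,v_0)$: let $H(\Gamma,v_0)=\{x_i\}_{i\in I(\Gamma,v_0)}$ be a set of indeterminates and $\mathbb{C}H(\Gamma,v_0)$ the free complex vector space on it. Define a bilinear operation (convolution) $\circ$ on $\mathbb{C}H(\Gamma,v_0)$ by $x_i\circ x_j=\sum_{k\in I(\Gamma,v_0)}p_{i,j}^k x_k$, where $$p_{i,j}^k=\frac{1}{|S_i(v_0)|}\sum_{v\in S_i(v_0)}\frac{|S_j(v)\cap S_k(v_0)|}{|S_j(v)|}.$$ Let $*$ be the conjugate-linear extension to $\mathbb{C}H(\Gamma,v_0)$ of the identity map on $H(\Gamma,v_0)$. Hermitian hypergroup: let $H=\{x_i\}_{i\in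 I}$ with $I=\{0,\dots,N\}$ or $I=\mathbb{N}_0$. A triple $(H,\circ,* )$, with $\circ:\mathbb{C}H\times\mathbb{C}H\to\mathbb{C}H$ and $*:\mathbb{C}H\to\mathbb{C}H$, is a discrete hypergroup if (1) $(\mathbb{C}H,\circ,* )$ is an (associative) $*$-algebra with unit $x_0$; (2) $*$ maps $H$ onto $H$; (3) writing $x_i\circ x_j=\sum_k q_{i,j}^k x_k$, one has $q_{i,j}^k\ge 0$, $\sum_k q_{i,j}^k=1$, and $q_{i,j}^0\ne 0$ if and only if $x_i=x_j^*$. It is hermitian if $*|_H$ is the identity map (then it is automatically commutative). $(\Gamma,v_0)$ is hypergroup productive if $(H(\Gamma,v_0),\circ,* )$ is a hermitian (discrete) hypergroup. *)

theory Defs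
  imports Complex_Main "HOL-Library.Extended_Nat" "HOL-Library.Countable_Set"
    "HOL-Library.Nonpos_Ints"
begin

text \<open>
  A simple graph is a vertex set \<open>V\<close> with a symmetric, irreflexive edge relation
  \<open>E \<subseteq> V \<times> V\<close>. A pair of vertices is in \<open>E ^^ n\<close> iff it is joined by a walk of length \<open>n\<close>.
\<close>

definition graph_dist :: "('a \<times> 'a) set \<Rightarrow> 'a \<Rightarrow> 'a \<Rightarrow> nat" where
  "graph_dist E v w = (LEAST n. (v, w) \<in> E ^^ n)"

definition eccentricity :: "'a set \<Rightarrow> ('a \<times> 'a) set \<Rightarrow> 'a \<Rightarrow> enat" where
  "eccentricity V E v = (SUP w\<in>V. enat (graph_dist E v w))"

locale pointed_graph =
  fixes V :: "'a set" and E :: "('a \<times> 'a) set" and v0 :: 'a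
  assumes edges_subset: "E \<subseteq> V \<times> V"
    and sym_edges: "sym E"
    and irrefl_edges: "irrefl E"
    and connected: "\<And>v w. v \<in> V \<Longrightarrow> w \<in> V \<Longrightarrow> (v, w) \<in> E\<^sup>*"
    and locally_finite: "\<And>v. v \<in> V \<Longrightarrow> finite (E `` {v})"
    and self_centered:
      "\<And>v w. v \<in> V \<Longrightarrow> w \<in> V \<Longrightarrow> eccentricity V E v = eccentricity V E w"
    and countable_vertices: "countable V"
    and base_point: "v0 \<in> V"

definition sphere :: "'a set \<Rightarrow> ('a \<times> 'a) set \<Rightarrow> nat \<Rightarrow> 'a \<Rightarrow> 'a set" where
  "sphere V E k v = {w \<in> V. graph_dist E v w = k}"

definition dist_set :: "'a set \<Rightarrow> ('a \<times> 'a) set \<Rightarrow> 'a \<Rightarrow> nat set" where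
  "dist_set V E v0 = graph_dist E v0 ` V"

text \<open>
  The free complex vector space on \<open>{x\<^sub>i}\<close>, \<open>i \<in> I\<close>, consists of the finitely supported
  coefficient functions vanishing outside \<open>I\<close>, with pointwise operations; \<open>indet i\<close> is \<open>x\<^sub>i\<close>.
\<close>

definition free_space :: "nat set \<Rightarrow> (nat \<Rightarrow> complex) set" where
  "free_space I = {f. finite {i. f i \<noteq> 0} \<and> {i. f i \<noteq> 0} \<subseteq> I}"

definition indet :: "nat \<Rightarrow> nat \<Rightarrow> complex" where
  "indet i = (\<lambda>j. if j = i then 1 else 0)"

locale star_algebra =
  fixes A :: "(nat \<Rightarrow> complex) set"
    and mult :: "(nat \<Rightarrow> complex) \<Rightarrow> (nat \<Rightarrow> complex) \<Rightarrow> (nat \<Rightarrow> complex)"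
    and star :: "(nat \<Rightarrow> complex) \<Rightarrow> (nat \<Rightarrow> complex)"
    and unit :: "nat \<Rightarrow> complex"
  assumes mult_closed: "\<And>f g. f \<in> A \<Longrightarrow> g \<in> A \<Longrightarrow> mult f g \<in> A"
    and mult_add_left: "\<And>f g h. f \<in> A \<Longrightarrow> g \<in> A \<Longrightarrow> h \<in> A \<Longrightarrow>
      mult (\<lambda>i. f i + g i) h = (\<lambda>i. mult f h i + mult g h i)"
    and mult_add_right: "\<And>f g h. f \<in> A \<Longrightarrow> g \<in> A \<Longrightarrow> h \<in> A \<Longrightarrow>
      mult f (\<lambda>i. g i + h i) = (\<lambda>i. mult f g i + mult f h i)"
    and mult_scale_left: "\<And>c f g. f \<in> A \<Longrightarrow> g \<in> A \<Longrightarrow>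
      mult (\<lambda>i. c * f i) g = (\<lambda>i. c * mult f g i)"
    and mult_scale_right: "\<And>c f g. f \<in> A \<Longrightarrow> g \<in> A \<Longrightarrow>
      mult f (\<lambda>i. c * g i) = (\<lambda>i. c * mult f g i)"
    and mult_assoc: "\<And>f g h. f \<in> A \<Longrightarrow> g \<in> A \<Longrightarrow> h \<in> A \<Longrightarrow>
      mult (mult f g) h = mult f (mult g h)"
    and unit_closed: "unit \<in> A"
    and unit_left: "\<And>f. f \<in> A \<Longrightarrow> mult unit f = f"
    and unit_right: "\<And>f. f \<in> A \<Longrightarrow> mult f unit = f"
    and star_closed: "\<And>f. f \<in> A \<Longrightarrow> star f \<in> A"
    and star_add: "\<And>f g. f \<in> A \<Longrightarrow> g \<in> A \<Longrightarrow>
      star (\<lambda>i. f i + g i) = (\<lambda>i. star f i + star g i)"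
    and star_scale: "\<And>c f. f \<in> A \<Longrightarrow> star (\<lambda>i. c * f i) = (\<lambda>i. cnj c * star f i)"
    and star_star: "\<And>f. f \<in> A \<Longrightarrow> star (star f) = f"
    and star_mult: "\<And>f g. f \<in> A \<Longrightarrow> g \<in> A \<Longrightarrow> star (mult f g) = mult (star g) (star f)"

text \<open>
  The structure constant \<open>q\<^bsub>i,j\<^esub>\<^sup>k\<close> is \<open>mult (indet i) (indet j) k\<close>.
\<close>

locale discrete_hypergroup =
  star_algebra "free_space I" mult star "indet 0"
  for I :: "nat set"
    and mult :: "(nat \<Rightarrow> complex) \<Rightarrow> (nat \<Rightarrow> complex) \<Rightarrow> (nat \<Rightarrow> complex)"
    and star :: "(nat \<Rightarrow> complex) \<Rightarrow> (nat \<Rightarrow> complex)" +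
  assumes index_set: "(\<exists>N. I = {0..N}) \<or> I = UNIV"
    and star_basis: "star ` (indet ` I) = indet ` I"
    and coeff_nonneg: "\<And>i j k. i \<in> I \<Longrightarrow> j \<in> I \<Longrightarrow> k \<in> I \<Longrightarrow>
      mult (indet i) (indet j) k \<in> \<real>\<^sub>\<ge>\<^sub>0"
    and coeff_sum: "\<And>i j. i \<in> I \<Longrightarrow> j \<in> I \<Longrightarrow>
      (\<Sum>k | mult (indet i) (indet j) k \<noteq> 0. mult (indet i) (indet j) k) = 1"
    and coeff_zero: "\<And>i j. i \<in> I \<Longrightarrow> j \<in> I \<Longrightarrow>
      mult (indet i) (indet j) 0 \<noteq> 0 \<longleftrightarrow> indet i = star (indet j)"

locale hermitian_hypergroup = discrete_hypergroup +
  assumes star_indet: "\<And>i. i \<in> I \<Longrightarrow> star (indet i) = indet i"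

definition graph_coeff ::
    "'a set \<Rightarrow> ('a \<times> 'a) set \<Rightarrow> 'a \<Rightarrow> nat \<Rightarrow> nat \<Rightarrow> nat \<Rightarrow> real" where
  "graph_coeff V E v0 i j k =
     1 / real (card (sphere V E i v0)) *
     (\<Sum>v\<in>sphere V E i v0.
        real (card (sphere V E j v \<inter> sphere V E k v0)) / real (card (sphere V E j v)))"

definition graph_conv ::
    "'a set \<Rightarrow> ('a \<times> 'a) set \<Rightarrow> 'a \<Rightarrow> (nat \<Rightarrow> complex) \<Rightarrow> (nat \<Rightarrow> complex) \<Rightarrow> (nat \<Rightarrow> complex)"
  where
  "graph_conv V E v0 f g = (\<lambda>k. if k \<in> dist_set V E v0
     then \<Sum>i | f i \<noteq> 0. \<Sum>j | g j \<noteq> 0. f i * g j * of_real (graph_coeff V E v0 i j k)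
     else 0)"

definition conj_star :: "(nat \<Rightarrow> complex) \<Rightarrow> (nat \<Rightarrow> complex)" where
  "conj_star f = (\<lambda>i. cnj (f i))"

definition hypergroup_productive :: "'a set \<Rightarrow> ('a \<times> 'a) set \<Rightarrow> 'a \<Rightarrow> bool" where
  "hypergroup_productive V E v0 \<longleftrightarrow>
     hermitian_hypergroup (dist_set V E v0) (graph_conv V E v0) conj_star"

end

theory Submission
  imports Defs
begin

text \<open>
  Let \<open>T i j k\<close> be the number of pairs \<open>(v, w)\<close> with \<open>d(v\<^sub>0, v) = i\<close>, \<open>d(v, w) = j\<close> and
  \<open>d(v\<^sub>0, w) = k\<close>, and let \<open>s i\<close> be the common cardinality of the spheres of radius \<open>i\<close>, so
  that \<open>p\<^bsub>i,j\<^esub>\<^sup>k = T i j k / (s i * s j)\<close>. The array \<open>T\<close> is symmetric in \<open>i\<close> and \<open>k\<close>, and its sum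
  over any one index is the product of the two remaining \<open>s\<close>. For three distances these marginals
  leave a single free parameter and force \<open>T\<close> to be totally symmetric, which gives commutativity.
  Moreover the marginal over \<open>j\<close> writes multiplication by \<open>x\<^sub>2\<close> as an affine combination of the
  identity, multiplication by \<open>x\<^sub>1\<close> and the operator \<open>x\<^sub>i \<mapsto> \<Sum>k. s k x\<^sub>k\<close>, and these three commute;
  associativity follows.
\<close>

section \<open>Convolution in coordinates and reduction to structure constants\<close>

lemma indet_in_free_space: "i \<in> I \<Longrightarrow> indet i \<in> free_space I"
  by (simp add: free_space_def indet_def)

lemma graph_coeff_nonneg: "graph_coeff V E v0 i j k \<ge> 0"
  by (simp add: graph_coeff_def sum_nonneg)

text \<open>The supports of \<open>f\<close> and \<open>g\<close> change under addition and scaling.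
  Padding the sums with zero terms up to the whole index set gives them a fixed range, from which
  bilinearity can be read off.\<close>

lemma graph_conv_eq:
  assumes "finite (dist_set V E v0)" "f \<in> free_space (dist_set V E v0)"
    "g \<in> free_space (dist_set V E v0)"
  shows "graph_conv V E v0 f g = (\<lambda>k. if k \<in> dist_set V E v0
    then \<Sum>i\<in>dist_set V E v0. \<Sum>j\<in>dist_set V E v0. f i * g j * of_real (graph_coeff V E v0 i j k)
    else 0)"
proof -
  have "(\<Sum>i | f i \<noteq> 0. \<Sum>j | g j \<noteq> 0. f i * g j * of_real (graph_coeff V E v0 i j k)) =
    (\<Sum>i\<in>dist_set V E v0. \<Sum>j\<in>dist_set V E v0. f i * g j * of_real (graph_coeff V E v0 i j k))" for k
  proof -
    have "(\<Sum>j | g j \<noteq> 0. f i * g j * of_real (graph_coeff V E v0 i j k)) =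
      (\<Sum>j\<in>dist_set V E v0. f i * g j * of_real (graph_coeff V E v0 i j k))" for i
      using assms by (intro sum.mono_neutral_left) (auto simp: free_space_def)
    then show ?thesis
      using assms by (simp, intro sum.mono_neutral_left) (auto simp: free_space_def)
  qed
  then show ?thesis
    by (simp add: graph_conv_def cong: if_cong)
qed

lemma graph_conv_indet:
  "graph_conv V E v0 (indet i) (indet j) k =
    (if k \<in> dist_set V E v0 then of_real (graph_coeff V E v0 i j k) else 0)"
proof -
  have "{l. indet m l \<noteq> 0} = {m}" for m
    by (auto simp: indet_def)
  then show ?thesis
    by (simp add: graph_conv_def) (simp add: indet_def)
qed

text \<open>By bilinearity every axiom of a hermitian hypergroup over a finite index set becomes an
  identity or inequality between the real numbers \<open>p i j k\<close>.\<close>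

lemma hypergroup_productiveI:
  fixes V :: "'a set" and E :: "('a \<times> 'a) set" and v0 :: 'a
  defines "I \<equiv> dist_set V E v0" and "p \<equiv> graph_coeff V E v0"
  assumes I: "I = {0..N}"
    and unit: "\<And>j k. j \<in> I \<Longrightarrow> k \<in> I \<Longrightarrow> p 0 j k = (if j = k then 1 else 0)"
    and comm: "\<And>i j k. i \<in> I \<Longrightarrow> j \<in> I \<Longrightarrow> k \<in> I \<Longrightarrow> p i j k = p j i k"
    and assoc: "\<And>i j k m. i \<in> I \<Longrightarrow> j \<in> I \<Longrightarrow> k \<in> I \<Longrightarrow> m \<in> I \<Longrightarrow>
      (\<Sum>l\<in>I. p i j l * p l k m) = (\<Sum>l\<in>I. p j k l * p i l m)"
    and stoch: "\<And>i j. i \<in> I \<Longrightarrow> j \<in> I \<Longrightarrow> (\<Sum>k\<in>I. p i j k) = 1"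
    and zero: "\<And>i j. i \<in> I \<Longrightarrow> j \<in> I \<Longrightarrow> p i j 0 \<noteq> 0 \<longleftrightarrow> i = j"
  shows "hypergroup_productive V E v0"
proof -
  let ?m = "graph_conv V E v0" and ?A = "free_space I"
  have fin: "finite I" and z: "0 \<in> I"
    by (simp_all add: I)
  \<comment> \<open>With \<open>I\<close> finite, finiteness of the support is automatic.\<close>
  have free: "f \<in> ?A \<longleftrightarrow> (\<forall>i. i \<notin> I \<longrightarrow> f i = 0)" for f
    using fin by (auto simp: free_space_def intro: finite_subset)
  have m: "?m f g = (\<lambda>k. if k \<in> I
      then \<Sum>i\<in>I. \<Sum>j\<in>I. f i * g j * of_real (p i j k) else 0)" if "f \<in> ?A" "g \<in> ?A" for f g
    using graph_conv_eq[of V E v0 f g] that fin unfolding I_def p_def by simp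
  have closed: "?m f g \<in> ?A" for f g
    unfolding free by (simp add: graph_conv_def I_def)
  have ind: "indet i \<in> ?A" if "i \<in> I" for i
    using that by (rule indet_in_free_space)
  have add: "(\<lambda>i. f i + g i) \<in> ?A" if "f \<in> ?A" "g \<in> ?A" for f g
    using that by (simp add: free)
  have scale: "(\<lambda>i. c * f i) \<in> ?A" if "f \<in> ?A" for c f
    using that by (simp add: free)
  have star: "conj_star f \<in> ?A" if "f \<in> ?A" for f
    using that by (simp add: free conj_star_def)
  have mcomm: "?m f g = ?m g f" if "f \<in> ?A" "g \<in> ?A" for f g
  proof
    fix k
    have "(\<Sum>i\<in>I. \<Sum>j\<in>I. f i * g j * of_real (p i j k)) =
        (\<Sum>j\<in>I. \<Sum>i\<in>I. f i * g j * of_real (p i j k))"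
      by (rule sum.swap)
    also have "\<dots> = (\<Sum>j\<in>I. \<Sum>i\<in>I. g j * f i * of_real (p j i k))" if "k \<in> I"
      using that by (intro sum.cong refl) (simp add: comm)
    finally show "?m f g k = ?m g f k"
      using that by (simp add: m)
  qed
  have unit_left: "?m (indet 0) f = f" if f: "f \<in> ?A" for f
  proof
    fix k
    have "(\<Sum>i\<in>I. \<Sum>j\<in>I. indet 0 i * f j * of_real (p i j k)) = f k" if k: "k \<in> I"
    proof -
      have "(\<Sum>i\<in>I. \<Sum>j\<in>I. indet 0 i * f j * of_real (p i j k)) =
          (\<Sum>i\<in>I. if i = 0 then \<Sum>j\<in>I. f j * of_real (p i j k) else 0)"
        by (intro sum.cong refl) (simp add: indet_def)
      also have "\<dots> = (\<Sum>j\<in>I. f j * of_real (p 0 j k))"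
        using fin z by simp
      also have "\<dots> = (\<Sum>j\<in>I. if j = k then f j else 0)"
        using k by (intro sum.cong refl) (simp add: unit)
      also have "\<dots> = f k"
        using fin k by simp
      finally show ?thesis .
    qed
    then show "?m (indet 0) f k = f k"
      using f ind[OF z] by (auto simp: m free)
  qed
  have massoc: "?m (?m f g) h = ?m f (?m g h)" if f: "f \<in> ?A" and g: "g \<in> ?A" and h: "h \<in> ?A" for f g h
  proof
    fix n
    have "(\<Sum>l\<in>I. \<Sum>k\<in>I. (\<Sum>i\<in>I. \<Sum>j\<in>I. f i * g j * of_real (p i j l)) * h k * of_real (p l k n)) =
        (\<Sum>i\<in>I. \<Sum>l\<in>I. f i * (\<Sum>j\<in>I. \<Sum>k\<in>I. g j * h k * of_real (p j k l)) * of_real (p i l n))"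
      (is "?L = ?R") if n: "n \<in> I"
    proof -
      \<comment> \<open>The summation over the intermediate index \<open>l\<close> is moved
        innermost, where \<open>assoc\<close> applies to the structure constants alone, and is then
        moved back out.\<close>
      have "?L = (\<Sum>l\<in>I. \<Sum>k\<in>I. \<Sum>i\<in>I. \<Sum>j\<in>I. f i * g j * h k * of_real (p i j l * p l k n))"
        by (simp add: sum_distrib_left sum_distrib_right mult_ac)
      also have "\<dots> = (\<Sum>k\<in>I. \<Sum>l\<in>I. \<Sum>i\<in>I. \<Sum>j\<in>I. f i * g j * h k * of_real (p i j l * p l k n))"
        by (rule sum.swap)
      also have "\<dots> = (\<Sum>k\<in>I. \<Sum>i\<in>I. \<Sum>l\<in>I. \<Sum>j\<in>I. f i * g j * h k * of_real (p i j l * p l k n))"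
        by (rule sum.cong[OF refl], rule sum.swap)
      also have "\<dots> = (\<Sum>k\<in>I. \<Sum>i\<in>I. \<Sum>j\<in>I. \<Sum>l\<in>I. f i * g j * h k * of_real (p i j l * p l k n))"
        by (rule sum.cong[OF refl], rule sum.cong[OF refl], rule sum.swap)
      also have "\<dots> = (\<Sum>k\<in>I. \<Sum>i\<in>I. \<Sum>j\<in>I. f i * g j * h k * of_real (\<Sum>l\<in>I. p i j l * p l k n))"
        by (simp add: sum_distrib_left)
      also have "\<dots> = (\<Sum>k\<in>I. \<Sum>i\<in>I. \<Sum>j\<in>I. f i * g j * h k * of_real (\<Sum>l\<in>I. p j k l * p i l n))"
        by (intro sum.cong refl) (simp add: assoc n del: of_real_sum)
      also have "\<dots> = (\<Sum>i\<in>I. \<Sum>k\<in>I. \<Sum>j\<in>I. f i * g j * h k * of_real (\<Sum>l\<in>I. p j k l * p i l n))"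
        by (rule sum.swap)
      also have "\<dots> = (\<Sum>i\<in>I. \<Sum>j\<in>I. \<Sum>k\<in>I. f i * g j * h k * of_real (\<Sum>l\<in>I. p j k l * p i l n))"
        by (rule sum.cong[OF refl], rule sum.swap)
      also have "\<dots> = (\<Sum>i\<in>I. \<Sum>j\<in>I. \<Sum>k\<in>I. \<Sum>l\<in>I. f i * g j * h k * of_real (p j k l * p i l n))"
        by (simp add: sum_distrib_left)
      also have "\<dots> = (\<Sum>i\<in>I. \<Sum>j\<in>I. \<Sum>l\<in>I. \<Sum>k\<in>I. f i * g j * h k * of_real (p j k l * p i l n))"
        by (rule sum.cong[OF refl], rule sum.cong[OF refl], rule sum.swap)
      also have "\<dots> = (\<Sum>i\<in>I. \<Sum>l\<in>I. \<Sum>j\<in>I. \<Sum>k\<in>I. f i * g j * h k * of_real (p j k l * p i l n))"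
        by (rule sum.cong[OF refl], rule sum.swap)
      also have "\<dots> = ?R"
        by (simp add: sum_distrib_left sum_distrib_right mult_ac)
      finally show ?thesis .
    qed
    then show "?m (?m f g) h n = ?m f (?m g h) n"
      using f g h by (simp add: m[OF closed h] m[OF f closed]) (simp add: m)
  qed
  have star_ind: "conj_star (indet i) = indet i" for i
    by (auto simp: conj_star_def indet_def)
  have ind_inj: "indet i = indet j \<longleftrightarrow> i = j" for i j
    by (metis indet_def zero_neq_one)
  have coeff: "?m (indet i) (indet j) k = (if k \<in> I then of_real (p i j k) else 0)" for i j k
    by (simp add: graph_conv_indet I_def p_def)
  show ?thesis
    unfolding hypergroup_productive_def I_def[symmetric]
  proof (unfold_locales, goal_cases)
    case (1 f g)
    show ?case by (rule closed)
  next
    case (2 f g h)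
    then show ?case
      by (auto simp: m add algebra_simps sum.distrib intro!: ext)
  next
    case (3 f g h)
    then show ?case
      by (auto simp: m add algebra_simps sum.distrib intro!: ext)
  next
    case (4 c f g)
    then show ?case
      by (auto simp: m scale sum_distrib_left mult_ac intro!: ext)
  next
    case (5 f g c)
    then show ?case
      by (auto simp: m scale sum_distrib_left mult_ac intro!: ext)
  next
    case (6 f g h)
    then show ?case by (rule massoc)
  next
    case 7
    show ?case using z by (rule ind)
  next
    case (8 f)
    then show ?case by (rule unit_left)
  next
    case (9 f)
    then show ?case using mcomm[OF _ ind[OF z]] unit_left by simp
  next
    case (10 f)
    then show ?case by (rule star)
  next
    case (11 f g)
    show ?case by (simp add: conj_star_def)
  next
    case (12 f c)
    show ?case by (simp add: conj_star_def)
  next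
    case (13 f)
    show ?case by (simp add: conj_star_def)
  next
    case (14 f g)
    \<comment> \<open>The structure constants are real, so conjugation preserves products in the
      given order. Commutativity then supplies the reversal demanded of an involution.\<close>
    have "conj_star (?m f g) = ?m (conj_star f) (conj_star g)"
      using 14 star by (auto simp: m conj_star_def intro!: ext)
    then show ?case using 14 mcomm star by simp
  next
    case 15
    show ?case using I by blast
  next
    case 16
    show ?case by (simp add: star_ind image_image)
  next
    case (17 i j k)
    then show ?case by (simp add: coeff p_def graph_coeff_nonneg)
  next
    case (18 i j)
    have "(\<Sum>k | ?m (indet i) (indet j) k \<noteq> 0. ?m (indet i) (indet j) k) =
        (\<Sum>k\<in>I. of_real (p i j k))"
      using fin by (intro sum.mono_neutral_cong_left) (auto simp: coeff split: if_splits)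
    then show ?case using stoch[OF 18] by (metis of_real_1 of_real_sum)
  next
    case (19 i j)
    then show ?case using z by (simp add: coeff star_ind ind_inj zero)
  next
    case (20 i)
    show ?case by (rule star_ind)
  qed
qed

section \<open>Distances and spheres in a pointed graph\<close>

lemma graph_dist_refl [simp]: "graph_dist E v v = 0"
  unfolding graph_dist_def by (rule Least_equality) auto

text \<open>A walk read backwards has the same length, so both minima range over the same
  set.\<close>

lemma graph_dist_commute:
  assumes "sym E"
  shows "graph_dist E v w = graph_dist E w v"
proof -
  have "(v, w) \<in> E ^^ n \<Longrightarrow> (w, v) \<in> E ^^ n" for n v w
  proof (induction n arbitrary: w)
    case (Suc n)
    then obtain u where "(v, u) \<in> E ^^ n" "(u, w) \<in> E"
      by auto
    with Suc.IH assms show ?case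
      by (meson relpow_Suc_I2 symD)
  qed simp
  then show ?thesis
    unfolding graph_dist_def by (intro arg_cong[where f = Least]) blast
qed

context pointed_graph
begin

text \<open>Connectedness provides some walk, so the \<open>LEAST\<close> in the distance is
  attained.\<close>

lemma walk_graph_dist:
  assumes "v \<in> V" "w \<in> V"
  shows "(v, w) \<in> E ^^ graph_dist E v w"
  unfolding graph_dist_def using connected[OF assms] by (metis LeastI rtrancl_imp_relpow)

lemma graph_dist_eq_0_iff: "v \<in> V \<Longrightarrow> w \<in> V \<Longrightarrow> graph_dist E v w = 0 \<longleftrightarrow> v = w"
  using walk_graph_dist by fastforce

lemma sphere_0: "v \<in> V \<Longrightarrow> sphere V E 0 v = {v}"
  by (auto simp: sphere_def graph_dist_eq_0_iff)

lemma finite_walk_ends: "v \<in> V \<Longrightarrow> finite ((E ^^ n) `` {v})"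
proof (induction n)
  case (Suc n)
  have "(E ^^ Suc n) `` {v} = (\<Union>u\<in>(E ^^ n) `` {v}. E `` {u})"
    by auto
  \<comment> \<open>Local finiteness speaks of vertices only; a point outside \<open>V\<close> has
    no neighbours at all.\<close>
  moreover have "finite (E `` {u})" for u
  proof (cases "u \<in> V")
    case False
    then have "E `` {u} = {}"
      using edges_subset by blast
    then show ?thesis
      by simp
  qed (rule locally_finite)
  ultimately show ?case
    using Suc by simp
qed simp

lemma finite_sphere: "v \<in> V \<Longrightarrow> finite (sphere V E k v)"
  by (rule finite_subset[OF _ finite_walk_ends[of v k]])
    (auto simp: sphere_def dest: walk_graph_dist)

lemma mem_sphere_commute:
  "v \<in> V \<Longrightarrow> w \<in> V \<Longrightarrow> w \<in> sphere V E j v \<longleftrightarrow> v \<in> sphere V E j w"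
  using graph_dist_commute[OF sym_edges] by (auto simp: sphere_def)

lemma sphere_subset: "sphere V E k v \<subseteq> V"
  by (auto simp: sphere_def)

lemma disjoint_spheres: "j \<noteq> k \<Longrightarrow> sphere V E j v \<inter> sphere V E k v = {}"
  by (auto simp: sphere_def)

text \<open>A bound on the distances from \<open>v0\<close> bounds its eccentricity, and
  self-centeredness transfers that bound to every other vertex.\<close>

lemma graph_dist_le:
  assumes "v \<in> V" "w \<in> V" "\<And>u. u \<in> V \<Longrightarrow> graph_dist E v0 u \<le> D"
  shows "graph_dist E v w \<le> D"
proof -
  have "enat (graph_dist E v w) \<le> eccentricity V E v"
    unfolding eccentricity_def using assms(2) by (rule SUP_upper)
  also have "\<dots> = eccentricity V E v0"
    using assms(1) base_point by (rule self_centered)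
  also have "\<dots> \<le> enat D"
    unfolding eccentricity_def using assms(3) by (intro SUP_least) simp
  finally show ?thesis
    by simp
qed

section \<open>The array \<open>T\<close> of the overview, as \<open>triple_count\<close>\<close>

definition triple_count :: "nat \<Rightarrow> nat \<Rightarrow> nat \<Rightarrow> nat" where
  "triple_count i j k = (\<Sum>v\<in>sphere V E i v0. card (sphere V E j v \<inter> sphere V E k v0))"

text \<open>Double counting: the same pairs \<open>(v, w)\<close> are grouped first by
  \<open>v\<close> and then by \<open>w\<close>, using that distance is symmetric.\<close>

lemma triple_count_commute: "triple_count i j k = triple_count k j i"
proof -
  have "(\<Sum>v\<in>sphere V E i v0. card (sphere V E j v \<inter> sphere V E k v0)) =
      (\<Sum>v\<in>sphere V E i v0. card {w \<in> sphere V E k v0. v \<in> sphere V E j w})"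
    using sphere_subset
    by (intro sum.cong refl arg_cong[where f = card]) (auto simp: mem_sphere_commute subset_iff)
  also have "\<dots> = (\<Sum>w\<in>sphere V E k v0. card {v \<in> sphere V E i v0. v \<in> sphere V E j w})"
    using finite_sphere[OF base_point] by (intro sum_multicount_gen) auto
  also have "\<dots> = (\<Sum>w\<in>sphere V E k v0. card (sphere V E j w \<inter> sphere V E i v0))"
    by (intro sum.cong refl arg_cong[where f = card]) auto
  finally show ?thesis
    by (simp add: triple_count_def)
qed

lemma triple_count_0_left:
  "triple_count 0 j k = (if j = k then card (sphere V E j v0) else 0)"
  by (simp add: triple_count_def sphere_0 base_point disjoint_spheres)

text \<open>A middle index \<open>0\<close> forces the two vertices of a pair to coincide.\<close>

lemma triple_count_0_middle:
  "triple_count i 0 k = (if i = k then card (sphere V E i v0) else 0)"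
proof -
  have "triple_count i 0 k = (\<Sum>v\<in>sphere V E i v0. if i = k then 1 else 0)"
    unfolding triple_count_def
  proof (intro sum.cong refl)
    fix v assume "v \<in> sphere V E i v0"
    then have "sphere V E 0 v \<inter> sphere V E k v0 = (if i = k then {v} else {})"
      by (auto simp: sphere_def graph_dist_eq_0_iff)
    then show "card (sphere V E 0 v \<inter> sphere V E k v0) = (if i = k then 1 else 0)"
      by simp
  qed
  then show ?thesis
    by simp
qed

end

section \<open>Marginals and total symmetry of \<open>T\<close> for three distances\<close>

locale sphere_regular_graph_2 = pointed_graph +
  assumes dist_set_eq: "dist_set V E v0 = {0, 1, 2}"
    and card_sphere_eq: "\<And>i v w. i \<in> {0, 1, 2} \<Longrightarrow> v \<in> V \<Longrightarrow> w \<in> V \<Longrightarrow>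
      card (sphere V E i v) = card (sphere V E i w)"
begin

text \<open>\<open>dist_set\<close> controls distances from \<open>v0\<close> only; constant
  eccentricity extends the bound \<open>2\<close> to every centre \<open>v\<close>.\<close>

lemma Un_spheres:
  assumes "v \<in> V"
  shows "(\<Union>k\<in>{0, 1, 2}. sphere V E k v) = V"
proof -
  have "graph_dist E v0 u \<le> 2" if "u \<in> V" for u
  proof -
    have "graph_dist E v0 u \<in> dist_set V E v0"
      using that by (simp add: dist_set_def)
    then show ?thesis
      unfolding dist_set_eq by auto
  qed
  then have "graph_dist E v w \<le> 2" if "w \<in> V" for w
    using that assms graph_dist_le by blast
  then have "graph_dist E v w \<in> {0, 1, 2}" if "w \<in> V" for w
    using that by (fastforce simp: le_Suc_eq numeral_2_eq_2)
  then show ?thesis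
    unfolding sphere_def by blast
qed

lemma sum_card_Int_spheres:
  assumes "v \<in> V" "finite A" "A \<subseteq> V"
  shows "(\<Sum>k\<in>{0, 1, 2}. card (A \<inter> sphere V E k v)) = card A"
proof -
  have "A = (\<Union>k\<in>{0, 1, 2}. A \<inter> sphere V E k v)"
    using Un_spheres[OF assms(1)] assms(3) by blast
  also have "card \<dots> = (\<Sum>k\<in>{0, 1, 2}. card (A \<inter> sphere V E k v))"
    using assms(2) by (intro card_UN_disjoint) (auto simp: sphere_def)
  finally show ?thesis ..
qed

abbreviation s :: "nat \<Rightarrow> nat" where
  "s i \<equiv> card (sphere V E i v0)"

lemma s_0: "s 0 = 1"
  by (simp add: sphere_0 base_point)

lemma s_pos:
  assumes "i \<in> {0, 1, 2}"
  shows "s i > 0"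
proof -
  have "i \<in> graph_dist E v0 ` V"
    using assms unfolding dist_set_eq[symmetric] dist_set_def .
  then have "sphere V E i v0 \<noteq> {}"
    by (auto simp: sphere_def)
  then show ?thesis
    using finite_sphere[OF base_point] by (simp add: card_gt_0_iff)
qed

text \<open>For each \<open>v\<close>, the spheres about \<open>v0\<close> partition the sphere of
  radius \<open>j\<close> about \<open>v\<close>, which has \<open>s j\<close> elements by
  regularity.\<close>

lemma sum_triple_count_right:
  assumes "j \<in> {0, 1, 2}"
  shows "(\<Sum>k\<in>{0, 1, 2}. triple_count i j k) = s i * s j"
proof -
  have "(\<Sum>k\<in>{0, 1, 2}. triple_count i j k) =
      (\<Sum>v\<in>sphere V E i v0. \<Sum>k\<in>{0, 1, 2}. card (sphere V E j v \<inter> sphere V E k v0))"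
    unfolding triple_count_def by (rule sum.swap)
  also have "\<dots> = (\<Sum>v\<in>sphere V E i v0. s j)"
  proof (intro sum.cong refl)
    fix v assume "v \<in> sphere V E i v0"
    then have "v \<in> V"
      by (simp add: sphere_def)
    then show "(\<Sum>k\<in>{0, 1, 2}. card (sphere V E j v \<inter> sphere V E k v0)) = s j"
      using sum_card_Int_spheres[OF base_point finite_sphere sphere_subset]
        card_sphere_eq[OF assms _ base_point] by simp
  qed
  finally show ?thesis
    by simp
qed

text \<open>Here the roles are exchanged: the spheres about \<open>v\<close> partition the sphere of
  radius \<open>k\<close> about \<open>v0\<close>.\<close>

lemma sum_triple_count_middle: "(\<Sum>j\<in>{0, 1, 2}. triple_count i j k) = s i * s k"
proof -
  have "(\<Sum>j\<in>{0, 1, 2}. triple_count i j k) =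
      (\<Sum>v\<in>sphere V E i v0. \<Sum>j\<in>{0, 1, 2}. card (sphere V E k v0 \<inter> sphere V E j v))"
    unfolding triple_count_def Int_commute[of "sphere V E k v0"] by (rule sum.swap)
  also have "\<dots> = (\<Sum>v\<in>sphere V E i v0. s k)"
    using sum_card_Int_spheres[OF _ finite_sphere[OF base_point] sphere_subset]
    by (intro sum.cong refl) (simp add: sphere_def)
  finally show ?thesis
    by simp
qed

lemma triple_count_swap:
  assumes "i \<in> {0, 1, 2}" "j \<in> {0, 1, 2}" "k \<in> {0, 1, 2}"
  shows "triple_count i j k = triple_count j i k"
proof -
  have edge: "triple_count 0 j k = triple_count j 0 k" for j k
    by (simp add: triple_count_0_left triple_count_0_middle)
  \<comment> \<open>Entries with an index \<open>0\<close> are known. The first two equations give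
    \<open>T 1 1 2 = T 1 2 1\<close>, and the left side is \<open>T 2 1 1\<close> by symmetry of the
    outer indices. The third and fifth then give \<open>T 1 2 2 = T 2 1 2\<close>.\<close>
  have eqs: "triple_count 1 1 0 + triple_count 1 1 1 + triple_count 1 1 2 = s 1 * s 1"
    "triple_count 1 0 1 + triple_count 1 1 1 + triple_count 1 2 1 = s 1 * s 1"
    "triple_count 1 2 0 + triple_count 1 2 1 + triple_count 1 2 2 = s 1 * s 2"
    "triple_count 1 0 2 + triple_count 1 1 2 + triple_count 1 2 2 = s 1 * s 2"
    "triple_count 2 1 0 + triple_count 2 1 1 + triple_count 2 1 2 = s 2 * s 1"
    using sum_triple_count_right[of 1 1] sum_triple_count_middle[of 1 1]
      sum_triple_count_right[of 2 1] sum_triple_count_middle[of 1 2]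
      sum_triple_count_right[of 1 2] by simp_all
  have sym: "triple_count i j 0 = triple_count 0 j i" for i j
    by (rule triple_count_commute)
  have "triple_count 1 2 k = triple_count 2 1 k" if "k \<in> {0, 1, 2}"
    using that eqs triple_count_commute[of 2 1 1]
    by (auto simp: sym triple_count_0_left triple_count_0_middle mult.commute)
  then show ?thesis
    using assms edge by auto
qed

section \<open>Identities between the structure constants\<close>

abbreviation p :: "nat \<Rightarrow> nat \<Rightarrow> nat \<Rightarrow> real" where
  "p \<equiv> graph_coeff V E v0"

lemma graph_coeff_eq:
  assumes "j \<in> {0, 1, 2}"
  shows "p i j k = real (triple_count i j k) / (real (s i) * real (s j))"
proof -
  have "card (sphere V E j v) = s j" if "v \<in> sphere V E i v0" for v
    using card_sphere_eq[OF assms _ base_point] that by (simp add: sphere_def)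
  then show ?thesis
    by (simp add: graph_coeff_def triple_count_def flip: sum_divide_distrib)
qed

lemma graph_coeff_unit:
  assumes "j \<in> {0, 1, 2}" "k \<in> {0, 1, 2}"
  shows "p 0 j k = (if j = k then 1 else 0)"
  using s_pos[OF assms(1)] by (auto simp: graph_coeff_eq[OF assms(1)] triple_count_0_left s_0)

lemma graph_coeff_commute:
  assumes "i \<in> {0, 1, 2}" "j \<in> {0, 1, 2}" "k \<in> {0, 1, 2}"
  shows "p i j k = p j i k"
  using triple_count_swap[OF assms] assms by (simp only: graph_coeff_eq mult.commute)

lemma sum_graph_coeff_right:
  assumes "i \<in> {0, 1, 2}" "j \<in> {0, 1, 2}"
  shows "(\<Sum>k\<in>{0, 1, 2}. p i j k) = 1"
proof -
  have "(\<Sum>k\<in>{0, 1, 2}. p i j k) =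
      real (\<Sum>k\<in>{0, 1, 2}. triple_count i j k) / (real (s i) * real (s j))"
    by (simp only: graph_coeff_eq[OF assms(2)] sum_divide_distrib of_nat_sum)
  then show ?thesis
    using s_pos[OF assms(1)] s_pos[OF assms(2)] by (simp only: sum_triple_count_right[OF assms(2)]) simp
qed

text \<open>The weight \<open>s j\<close> cancels the factor \<open>s j\<close> in the denominator
  of \<open>p i j k\<close>, leaving the marginal of \<open>T\<close> over its middle index.\<close>

lemma sum_graph_coeff_middle:
  assumes "i \<in> {0, 1, 2}"
  shows "(\<Sum>j\<in>{0, 1, 2}. real (s j) * p i j k) = real (s k)"
proof -
  have "(\<Sum>j\<in>{0, 1, 2}. real (s j) * p i j k) =
      (\<Sum>j\<in>{0, 1, 2}. real (triple_count i j k) / real (s i))"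
    using s_pos by (intro sum.cong refl) (simp add: graph_coeff_eq)
  also have "\<dots> = real (\<Sum>j\<in>{0, 1, 2}. triple_count i j k) / real (s i)"
    by (simp only: sum_divide_distrib of_nat_sum)
  finally show ?thesis
    using s_pos[OF assms] by (simp only: sum_triple_count_middle) simp
qed

text \<open>This solves the weighted marginal for its last term. For the matrices \<open>A j\<close>
  with entries \<open>p i j k\<close> in row \<open>i\<close> and column \<open>k\<close>, and
  \<open>J\<close> with entries \<open>s k\<close>, it reads
  \<open>s 2 * A 2 = J - 1 - s 1 * A 1\<close>.\<close>

lemma graph_coeff_2:
  assumes "i \<in> {0, 1, 2}" "k \<in> {0, 1, 2}"
  shows "p i 2 k = (real (s k) - (if i = k then 1 else 0) - real (s 1) * p i 1 k) / real (s 2)"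
proof -
  have "p i 0 k = (if i = k then 1 else 0)"
    using graph_coeff_unit[OF assms] graph_coeff_commute[OF _ assms(1) assms(2), of 0] by simp
  then show ?thesis
    using sum_graph_coeff_middle[OF assms(1), of k] s_pos[of 2] s_0 by (simp add: field_simps)
qed

text \<open>The matrices \<open>A j\<close> of right multiplication by \<open>x j\<close> commute.
  \<open>A 0\<close> is the identity and \<open>A 2\<close> is a combination of \<open>J\<close>,
  \<open>1\<close> and \<open>A 1\<close>, so it suffices that \<open>A 1\<close> commutes with
  \<open>J\<close>.\<close>

lemma graph_coeff_right_commute:
  assumes "i \<in> {0, 1, 2}" "j \<in> {0, 1, 2}" "k \<in> {0, 1, 2}" "m \<in> {0, 1, 2}"
  shows "(\<Sum>l\<in>{0, 1, 2}. p i j l * p l k m) = (\<Sum>l\<in>{0, 1, 2}. p i k l * p l j m)"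
proof -
  have unit: "p i 0 k = (if i = k then 1 else 0)" if "i \<in> {0, 1, 2}" "k \<in> {0, 1, 2}" for i k
    using graph_coeff_unit[OF that] graph_coeff_commute[OF _ that, of 0] by simp
  have 0: "(\<Sum>l\<in>{0, 1, 2}. p i 0 l * p l k m) = (\<Sum>l\<in>{0, 1, 2}. p i k l * p l 0 m)" for k
    using assms(1,4) by (auto simp: unit)
  \<comment> \<open>This is \<open>J * A 1 = J\<close>; the opposite product
    \<open>A 1 * J = J\<close> expresses that the rows of \<open>A 1\<close> sum to
    \<open>1\<close>.\<close>
  have weighted: "(\<Sum>l\<in>{0, 1, 2}. real (s l) * p l 1 m) = real (s m)"
  proof -
    have "(\<Sum>l\<in>{0, 1, 2}. real (s l) * p l 1 m) = (\<Sum>l\<in>{0, 1, 2}. real (s l) * p 1 l m)"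
      using assms(4) by (intro sum.cong refl) (simp only: graph_coeff_commute[of _ 1 m] insert_iff simp_thms)
    then show ?thesis
      using sum_graph_coeff_middle[of 1 m] by simp
  qed
  have "real (s 2) * (\<Sum>l\<in>{0, 1, 2}. p i 1 l * p l 2 m) =
      (\<Sum>l\<in>{0, 1, 2}. p i 1 l * (real (s m) - (if l = m then 1 else 0) - real (s 1) * p l 1 m))"
    unfolding sum_distrib_left
    using assms(4) s_pos[of 2] by (intro sum.cong refl) (simp add: graph_coeff_2)
  also have "\<dots> = real (s m) * (\<Sum>l\<in>{0, 1, 2}. p i 1 l) - p i 1 m
      - real (s 1) * (\<Sum>l\<in>{0, 1, 2}. p i 1 l * p l 1 m)"
    using assms(4) by (auto simp: algebra_simps)
  also have "\<dots> = real (s m) - p i 1 m - real (s 1) * (\<Sum>l\<in>{0, 1, 2}. p i 1 l * p l 1 m)"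
    using sum_graph_coeff_right[OF assms(1), of 1] by simp
  \<comment> \<open>Writing \<open>s m\<close> as the weighted column sum puts a factor
    \<open>p l 1 m\<close> in every term, so that \<open>p i 2 l\<close> can be reassembled on the
    left.\<close>
  also have "\<dots> = (\<Sum>l\<in>{0, 1, 2}. (real (s l) - (if i = l then 1 else 0) - real (s 1) * p i 1 l) * p l 1 m)"
    unfolding weighted[symmetric] using assms(1) by (auto simp: algebra_simps)
  also have "\<dots> = real (s 2) * (\<Sum>l\<in>{0, 1, 2}. p i 2 l * p l 1 m)"
    unfolding sum_distrib_left
    using assms(1) s_pos[of 2] by (intro sum.cong refl) (simp add: graph_coeff_2)
  finally have 12: "(\<Sum>l\<in>{0, 1, 2}. p i 1 l * p l 2 m) = (\<Sum>l\<in>{0, 1, 2}. p i 2 l * p l 1 m)"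
    using s_pos[of 2] by simp
  consider "j = k" | "j = 0" | "k = 0" | "j = 1" "k = 2" | "j = 2" "k = 1"
    using assms(2,3) by blast
  then show ?thesis
  proof cases
    case 1
    then show ?thesis by simp
  next
    case 2
    show ?thesis unfolding 2 by (rule 0)
  next
    case 3
    show ?thesis unfolding 3 by (rule 0[symmetric])
  next
    case 4
    show ?thesis unfolding 4 by (rule 12)
  next
    case 5
    show ?thesis unfolding 5 by (rule 12[symmetric])
  qed
qed

text \<open>Given commutativity, commuting right multiplications suffice: \<open>(x i x j) x k = (x
  j x i) x k = (x j x k) x i = x i (x j x k)\<close>.\<close>

lemma graph_coeff_assoc:
  assumes "i \<in> {0, 1, 2}" "j \<in> {0, 1, 2}" "k \<in> {0, 1, 2}" "m \<in> {0, 1, 2}"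
  shows "(\<Sum>l\<in>{0, 1, 2}. p i j l * p l k m) = (\<Sum>l\<in>{0, 1, 2}. p j k l * p i l m)"
proof -
  have "(\<Sum>l\<in>{0, 1, 2}. p i j l * p l k m) = (\<Sum>l\<in>{0, 1, 2}. p j i l * p l k m)"
    using assms by (intro sum.cong refl) (simp only: graph_coeff_commute[of i j])
  also have "\<dots> = (\<Sum>l\<in>{0, 1, 2}. p j k l * p l i m)"
    using assms by (intro graph_coeff_right_commute)
  also have "\<dots> = (\<Sum>l\<in>{0, 1, 2}. p j k l * p i l m)"
    using assms by (intro sum.cong refl) (simp only: graph_coeff_commute[of i _ m])
  finally show ?thesis .
qed

text \<open>The numerator is \<open>T i j 0 = T 0 j i\<close>, which is \<open>s j\<close> on the
  diagonal and \<open>0\<close> off it, and every sphere in question is nonempty.\<close>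

lemma graph_coeff_0_right:
  assumes "i \<in> {0, 1, 2}" "j \<in> {0, 1, 2}"
  shows "p i j 0 \<noteq> 0 \<longleftrightarrow> i = j"
  using s_pos[OF assms(1)] s_pos[OF assms(2)]
  unfolding graph_coeff_eq[OF assms(2)] triple_count_commute[of i j 0]
  by (auto simp: triple_count_0_left)

theorem hypergroup_productive: "hypergroup_productive V E v0"
proof (rule hypergroup_productiveI[where N = 2], unfold dist_set_eq)
  show "{0, 1, 2} = {0..2::nat}"
    by auto
qed (rule graph_coeff_unit graph_coeff_commute graph_coeff_assoc sum_graph_coeff_right
  graph_coeff_0_right; assumption)+

end

theorem corollary4p1:
  fixes V :: "'a set" and E :: "('a \<times> 'a) set" and v0 :: 'a
  assumes graph: "pointed_graph V E v0"
    and dist_012: "dist_set V E v0 = {0, 1, 2}"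
    and S1: "\<And>i v w. i \<in> dist_set V E v0 \<Longrightarrow> v \<in> V \<Longrightarrow> w \<in> V \<Longrightarrow>
      card (sphere V E i v) = card (sphere V E i w)"
    and S2: "\<And>i j k v w. i \<in> dist_set V E v0 \<Longrightarrow> j \<in> dist_set V E v0 \<Longrightarrow>
      k \<in> dist_set V E v0 \<Longrightarrow> v \<in> sphere V E k v0 \<Longrightarrow> w \<in> sphere V E k v0 \<Longrightarrow>
      card (sphere V E i v \<inter> sphere V E j v0) = card (sphere V E i w \<inter> sphere V E j v0)"
  shows "hypergroup_productive V E v0"
proof -
  interpret sphere_regular_graph_2 V E v0
    using graph dist_012 S1[unfolded dist_012]
    by (rule sphere_regular_graph_2.intro[OF _ sphere_regular_graph_2_axioms.intro])
  show ?thesis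
    by (rule hypergroup_productive)
qed

end
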